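(* Let $N\in\mathbb{N}$, $N\ge 1$, let $s_1,\dots,s_N\in\mathbb{R}\setminus\{0\}$, and let $\boldsymbol{\Xi}_0=(\Xi_{10},\dots,\Xi_{N0})\in\mathcal{Y}$. Then the Cauchy problem $$\dot{\Xi}_k(T)=\hat F_k(\Xi_1(T),\dots,\Xi_N(T)),\qquad \Xi_k(0)=\Xi_{k0},\qquad k=1,\dots,N,$$ where $\hat F_k=-\nabla_{\Xi_k}\hat H$, has a unique local solution, i.e. there is a neighbourhood of $T=0$ on which there exists exactly one solution $T\mapsto(\Xi_1(T),\dots,\Xi_N(T))\in\mathcal{Y}$.
   Context: $B_1(0)\subset\mathbb{R}^2$ is the open unit disk centred at the origin. The superposition set is $\Pi=\bigcup_{1\le k<h\le N}\{(\Xi_1,\dots,\Xi_N)\in[B_1(0)]^N:\Xi_k=\Xi_h\}$ and $\mathcal{Y}=[B_1(0)]^N\setminus\Pi$. For $\Xi_k\ne\Xi_h$ in $B_1(0)$ set $$\Phi_{kh}=\frac{|\Xi_k-\Xi_h|^2}{|\Xi_k-\Xi_h|^2+(1-|\Xi_k|^2)(1-|\Xi_h|^2)}\in(0,1).$$ The non-dimensional elastic energy $\hat H:\mathcal{Y}\to\mathbb{R}$ is $$\hat H(\Xi_1,\dots,\Xi_N)=\frac12\sum_{k=1}^N s_k^2(1-|\Xi_k|^2)^2+\sum_{1\le k<h\le N}s_ks_h(1-|\Xi_h|^2)(1-|\Xi_k|^2)+\sum_{1\le k<h\le N}s_ks_h|\Xi_h-\Xi_k|^2\log\Phi_{kh}.$$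 Explicitly, the forces $\hat F_k=-\nabla_{\Xi_k}\hat H$ are $$\hat F_k=2s_k^2(1-|\Xi_k|^2)\Xi_k+\sum_{h\neq k}2s_ks_h(1-\Phi_{kh})(1-|\Xi_h|^2)\Xi_k+\sum_{h\ne k}2s_ks_h(1-\Phi_{kh}+\log\Phi_{kh})(\Xi_h-\Xi_k).$$ A dot denotes $\mathrm{d}/\mathrm{d}T$. *)

theory Defs
  imports "HOL-Analysis.Analysis"
begin

text \<open>
  The \<open>N\<close> points are indexed by an arbitrary finite linearly ordered type \<open>'n\<close> with
  \<open>N = CARD('n)\<close>, which is automatically at least 1; the order is the one used in sums over
  pairs \<open>k < h\<close>.
\<close>

definition superposition_set :: "((real^2)^'n::{finite,linorder}) set" where
  "superposition_set =
    (\<Union>k. \<Union>h\<in>{k<..}. {\<Xi>. (\<forall>i. \<Xi> $ i \<in> ball 0 1) \<and> \<Xi> $ k = \<Xi> $ h})"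

definition config_space :: "((real^2)^'n::{finite,linorder}) set" where
  "config_space = {\<Xi>. \<forall>i. \<Xi> $ i \<in> ball 0 1} - superposition_set"

definition Phi :: "real^2 \<Rightarrow> real^2 \<Rightarrow> real" where
  "Phi x y = (norm (x - y))\<^sup>2 /
     ((norm (x - y))\<^sup>2 + (1 - (norm x)\<^sup>2) * (1 - (norm y)\<^sup>2))"

text \<open>
  The energy is a total function here; only its values on \<^const>\<open>config_space\<close>, which is open,
  are meaningful.
\<close>

definition energy :: "real^'n::{finite,linorder} \<Rightarrow> (real^2)^'n::{finite,linorder} \<Rightarrow> real" where
  "energy s \<Xi> =
     1/2 * (\<Sum>k\<in>UNIV. (s $ k)\<^sup>2 * (1 - (norm (\<Xi> $ k))\<^sup>2)\<^sup>2)
     + (\<Sum>k\<in>UNIV. \<Sum>h\<in>{k<..}.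
          s $ k * s $ h * (1 - (norm (\<Xi> $ h))\<^sup>2) * (1 - (norm (\<Xi> $ k))\<^sup>2))
     + (\<Sum>k\<in>UNIV. \<Sum>h\<in>{k<..}.
          s $ k * s $ h * (norm (\<Xi> $ h - \<Xi> $ k))\<^sup>2 * ln (Phi (\<Xi> $ k) (\<Xi> $ h)))"

definition partial_gradient ::
  "((real^2)^'n::{finite,linorder} \<Rightarrow> real) \<Rightarrow> 'n \<Rightarrow> (real^2)^'n::{finite,linorder} \<Rightarrow> real^2" where
  "partial_gradient f k \<Xi> =
     (THE D. GDERIV (\<lambda>x. f (\<chi> i. if i = k then x else \<Xi> $ i)) (\<Xi> $ k) :> D)"

definition force :: "real^'n::{finite,linorder} \<Rightarrow> 'n \<Rightarrow> (real^2)^'n::{finite,linorder} \<Rightarrow> real^2" where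
  "force s k \<Xi> = - partial_gradient (energy s) k \<Xi>"

definition solves_cauchy_problem ::
  "real^'n::{finite,linorder} \<Rightarrow> (real^2)^'n::{finite,linorder} \<Rightarrow> real set \<Rightarrow> (real \<Rightarrow> (real^2)^'n::{finite,linorder}) \<Rightarrow> bool" where
  "solves_cauchy_problem s \<Xi>\<^sub>0 I \<Xi> \<longleftrightarrow>
     \<Xi> 0 = \<Xi>\<^sub>0 \<and>
     (\<forall>T\<in>I. \<Xi> T \<in> config_space \<and>
        (\<forall>k. ((\<lambda>t. \<Xi> t $ k) has_vector_derivative force s k (\<Xi> T)) (at T within I)))"

text \<open>
  The description in \<^const>\<open>partial_gradient\<close> is proper on \<^const>\<open>config_space\<close>: the gradient
  exists there and the force is given by an explicit formula.
\<close>

lemma ball_norm_sq: "x \<in> ball 0 1 \<Longrightarrow> (norm x)\<^sup>2 < 1" for x :: "real^2"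
  by (simp add: abs_square_less_1)

lemma GDERIV_unique:
  assumes "GDERIV f x :> D" "GDERIV f x :> E"
  shows "D = E"
proof -
  have "(\<lambda>h. inner h D) = (\<lambda>h. inner h E)"
    using assms unfolding gderiv_def by (rule has_derivative_unique)
  then have "inner (D - E) (D - E) = 0"
    by (metis inner_diff_right right_minus_eq)
  then show ?thesis by simp
qed

lemma GDERIV_norm_sq_diff: "GDERIV (\<lambda>x. (norm (x - b))\<^sup>2) a :> 2 *\<^sub>R (a - b)"
  for a b :: "real^2"
  unfolding gderiv_def power2_norm_eq_inner
  by (auto intro!: derivative_eq_intros ext simp: inner_commute algebra_simps inner_simps)

lemma Phi_commute: "Phi x y = Phi y x"
  unfolding Phi_def by (simp add: norm_minus_commute mult.commute)

lemma Phi_pos_less_one: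
  assumes "a \<in> ball 0 1" "b \<in> ball 0 1" "a \<noteq> b"
  shows "0 < Phi a b" "Phi a b < 1"
proof -
  have "(norm (a - b))\<^sup>2 > 0" using assms by simp
  moreover have "(1 - (norm a)\<^sup>2) * (1 - (norm b)\<^sup>2) > 0"
    by (intro mult_pos_pos) (use assms ball_norm_sq in force)+
  ultimately show "0 < Phi a b" "Phi a b < 1"
    unfolding Phi_def by (auto simp: divide_simps add_pos_pos)
qed

definition pair_energy :: "real^2 \<Rightarrow> real^2 \<Rightarrow> real" where
  "pair_energy x y =
     (1 - (norm x)\<^sup>2) * (1 - (norm y)\<^sup>2) + (norm (x - y))\<^sup>2 * ln (Phi x y)"

lemma pair_energy_commute: "pair_energy x y = pair_energy y x"
  unfolding pair_energy_def by (simp add: norm_minus_commute mult.commute Phi_commute)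

lemma GDERIV_pair_energy:
  assumes "a \<in> ball 0 1" "b \<in> ball 0 1" "a \<noteq> b"
  shows "GDERIV (\<lambda>x. pair_energy x b) a :>
    - ((2 * (1 - Phi a b) * (1 - (norm b)\<^sup>2)) *\<^sub>R a
       + (2 * (1 - Phi a b + ln (Phi a b))) *\<^sub>R (b - a))"
proof -
  define q where "q = 1 - (norm b)\<^sup>2"
  define u where "u = (\<lambda>x::real^2. (norm (x - b))\<^sup>2)"
  define v where "v = (\<lambda>x::real^2. (1 - (norm x)\<^sup>2) * q)"
  have du: "(u has_derivative (\<lambda>h. inner h (2 *\<^sub>R (a - b)))) (at a)"
    using GDERIV_norm_sq_diff[of b a] unfolding u_def gderiv_def .
  have "((\<lambda>x. (norm x)\<^sup>2) has_derivative (\<lambda>h. inner h (2 *\<^sub>R a))) (at a)"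
    using GDERIV_norm_sq_diff[of 0 a] unfolding gderiv_def by simp
  then have dv: "(v has_derivative (\<lambda>h. - inner h (2 *\<^sub>R a) * q)) (at a)"
    unfolding v_def by (auto intro!: has_derivative_eq_rhs[OF has_derivative_mult_left[OF
      has_derivative_diff[OF has_derivative_const]]])
  have u: "u a > 0" using assms unfolding u_def by simp
  have v: "v a > 0" unfolding v_def q_def
    by (intro mult_pos_pos) (use assms ball_norm_sq in force)+
  have dP: "((\<lambda>x. u x / (u x + v x)) has_derivative
      (\<lambda>h. (inner h (2 *\<^sub>R (a - b)) * v a + u a * (inner h (2 *\<^sub>R a) * q)) / (u a + v a)\<^sup>2)) (at a)"
    using u v
    by (auto intro!: derivative_eq_intros du dv ext simp: power2_eq_square field_simps)
  have P: "u a / (u a + v a) > 0" using u v by simp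
  have "((\<lambda>x. v x + u x * ln (u x / (u x + v x))) has_derivative
      (\<lambda>h. - inner h (2 *\<^sub>R a) * q + (u a *
        (((inner h (2 *\<^sub>R (a - b)) * v a + u a * (inner h (2 *\<^sub>R a) * q)) / (u a + v a)\<^sup>2)
          / (u a / (u a + v a)))
        + inner h (2 *\<^sub>R (a - b)) * ln (u a / (u a + v a))))) (at a)"
  proof -
    define R where "R = (\<lambda>x. u x / (u x + v x))"
    have dR: "(R has_derivative
        (\<lambda>h. (inner h (2 *\<^sub>R (a - b)) * v a + u a * (inner h (2 *\<^sub>R a) * q)) / (u a + v a)\<^sup>2)) (at a)"
      using dP unfolding R_def .
    have "R a > 0" using P unfolding R_def .
    from has_derivative_ln[OF this dR]
    have dl: "((\<lambda>x. ln (R x)) has_derivative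
        (\<lambda>h. (inner h (2 *\<^sub>R (a - b)) * v a + u a * (inner h (2 *\<^sub>R a) * q)) / (u a + v a)\<^sup>2 / R a)) (at a)"
      by (simp add: divide_inverse)
    have "((\<lambda>x. v x + u x * ln (R x)) has_derivative
      (\<lambda>h. - inner h (2 *\<^sub>R a) * q + (u a *
        (((inner h (2 *\<^sub>R (a - b)) * v a + u a * (inner h (2 *\<^sub>R a) * q)) / (u a + v a)\<^sup>2) / R a)
        + inner h (2 *\<^sub>R (a - b)) * ln (R a)))) (at a)"
      by (intro has_derivative_add dv has_derivative_mult du dl)
    then show ?thesis unfolding R_def .
  qed
  moreover have "pair_energy x b = v x + u x * ln (u x / (u x + v x))" for x
    unfolding pair_energy_def Phi_def u_def v_def q_def ..
  moreover have "- inner h (2 *\<^sub>R a) * q + (u a *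
        (((inner h (2 *\<^sub>R (a - b)) * v a + u a * (inner h (2 *\<^sub>R a) * q)) / (u a + v a)\<^sup>2)
          / (u a / (u a + v a)))
        + inner h (2 *\<^sub>R (a - b)) * ln (u a / (u a + v a)))
     = inner h (- ((2 * (1 - Phi a b) * (1 - (norm b)\<^sup>2)) *\<^sub>R a
       + (2 * (1 - Phi a b + ln (Phi a b))) *\<^sub>R (b - a)))" for h
  proof -
    define p where "p = Phi a b"
    have p: "p = u a / (u a + v a)"
      unfolding p_def Phi_def u_def v_def q_def ..
    have vp: "1 - p = v a / (u a + v a)"
      using u v unfolding p by (simp add: field_simps)
    have *: "u a * (((X * v a + u a * Y) / (u a + v a)\<^sup>2) / (u a / (u a + v a)))
        = X * (1 - p) + p * Y" for X Y
    proof -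
      have "U * ((M / S\<^sup>2) / (U / S)) = M / S" if "U > 0" "S > 0" for U M S :: real
        using that by (simp add: divide_simps power2_eq_square)
      note this[OF u add_pos_pos[OF u v], of "X * v a + u a * Y"]
      also have "(X * v a + u a * Y) / (u a + v a)
          = X * (v a / (u a + v a)) + u a / (u a + v a) * Y"
        by (simp add: add_divide_distrib)
      finally show ?thesis
        unfolding vp unfolding p .
    qed
    show ?thesis
      unfolding * unfolding p[symmetric] p_def[symmetric] q_def[symmetric]
      by (simp add: inner_simps algebra_simps)
  qed
  ultimately show ?thesis
    unfolding gderiv_def by simp
qed

lemma energy_pair_energy:
  "energy s \<Xi> = 1/2 * (\<Sum>k\<in>UNIV. (s $ k)\<^sup>2 * (1 - (norm (\<Xi> $ k))\<^sup>2)\<^sup>2)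
     + (\<Sum>k\<in>UNIV. \<Sum>h\<in>{k<..}. s $ k * s $ h * pair_energy (\<Xi> $ k) (\<Xi> $ h))"
  unfolding energy_def pair_energy_def
  by (simp add: sum.distrib[symmetric] norm_minus_commute algebra_simps)

lemma sum_pairs_containing:
  fixes f :: "'n::{finite,linorder} \<Rightarrow> 'n \<Rightarrow> real"
  assumes "\<And>i j. f i j = f j i"
  shows "(\<Sum>i\<in>UNIV. \<Sum>j\<in>{i<..}. f i j) =
    (\<Sum>h\<in>UNIV - {k}. f k h) + (\<Sum>i\<in>UNIV - {k}. \<Sum>j\<in>{i<..} - {k}. f i j)"
proof -
  have "(\<Sum>i\<in>UNIV. \<Sum>j\<in>{i<..}. f i j) =
      (\<Sum>j\<in>{k<..}. f k j) + (\<Sum>i\<in>UNIV - {k}. \<Sum>j\<in>{i<..}. f i j)"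
    by (rule sum.remove) auto
  also have "(\<Sum>i\<in>UNIV - {k}. \<Sum>j\<in>{i<..}. f i j) =
      (\<Sum>i\<in>UNIV - {k}. (if i < k then f i k else 0) + (\<Sum>j\<in>{i<..} - {k}. f i j))"
    by (rule sum.cong) (auto simp: sum.remove[of _ k])
  also have "\<dots> = (\<Sum>i\<in>UNIV - {k}. if i < k then f i k else 0)
      + (\<Sum>i\<in>UNIV - {k}. \<Sum>j\<in>{i<..} - {k}. f i j)"
    by (rule sum.distrib)
  also have "(\<Sum>i\<in>UNIV - {k}. if i < k then f i k else 0) = (\<Sum>i\<in>{..<k}. f k i)"
    by (rule sum.mono_neutral_cong_right) (auto simp: assms)
  finally have "(\<Sum>i\<in>UNIV. \<Sum>j\<in>{i<..}. f i j) =
      ((\<Sum>j\<in>{k<..}. f k j) + (\<Sum>i\<in>{..<k}. f k i))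
      + (\<Sum>i\<in>UNIV - {k}. \<Sum>j\<in>{i<..} - {k}. f i j)" by simp
  also have "(\<Sum>j\<in>{k<..}. f k j) + (\<Sum>i\<in>{..<k}. f k i) = (\<Sum>h\<in>{k<..} \<union> {..<k}. f k h)"
    by (rule sum.union_disjoint[symmetric]) auto
  also have "{k<..} \<union> {..<k} = UNIV - {k}" by auto
  finally show ?thesis .
qed

lemma GDERIV_energy:
  fixes s :: "real^'n::{finite,linorder}"
  assumes "\<Xi> \<in> config_space"
  shows "GDERIV (\<lambda>x. energy s (\<chi> i. if i = k then x else \<Xi> $ i)) (\<Xi> $ k) :>
    - ((2 * (s $ k)\<^sup>2 * (1 - (norm (\<Xi> $ k))\<^sup>2)) *\<^sub>R \<Xi> $ k
       + (\<Sum>h\<in>UNIV - {k}. (2 * s $ k * s $ h * (1 - Phi (\<Xi> $ k) (\<Xi> $ h))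
            * (1 - (norm (\<Xi> $ h))\<^sup>2)) *\<^sub>R \<Xi> $ k)
       + (\<Sum>h\<in>UNIV - {k}. (2 * s $ k * s $ h * (1 - Phi (\<Xi> $ k) (\<Xi> $ h)
            + ln (Phi (\<Xi> $ k) (\<Xi> $ h)))) *\<^sub>R (\<Xi> $ h - \<Xi> $ k)))"
proof -
  have in_ball: "\<Xi> $ i \<in> ball 0 1" for i
    using assms unfolding config_space_def by auto
  have neq_less: "\<Xi> $ i \<noteq> \<Xi> $ j" if "i < j" for i j
  proof
    assume "\<Xi> $ i = \<Xi> $ j"
    then have "\<Xi> \<in> superposition_set"
      unfolding superposition_set_def using that in_ball by blast
    then show False using assms unfolding config_space_def by blast
  qed
  have neq: "\<Xi> $ k \<noteq> \<Xi> $ h" if "h \<noteq> k" for h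
    using that neq_less[of h k] neq_less[of k h] by (metis linorder_neqE)
  define c where "c = 1/2 * (\<Sum>i\<in>UNIV - {k}. (s $ i)\<^sup>2 * (1 - (norm (\<Xi> $ i))\<^sup>2)\<^sup>2)
     + (\<Sum>i\<in>UNIV - {k}. \<Sum>j\<in>{i<..} - {k}. s $ i * s $ j * pair_energy (\<Xi> $ i) (\<Xi> $ j))"
  define G where "G = (\<lambda>h. - ((2 * (1 - Phi (\<Xi> $ k) (\<Xi> $ h)) * (1 - (norm (\<Xi> $ h))\<^sup>2)) *\<^sub>R \<Xi> $ k
       + (2 * (1 - Phi (\<Xi> $ k) (\<Xi> $ h) + ln (Phi (\<Xi> $ k) (\<Xi> $ h)))) *\<^sub>R (\<Xi> $ h - \<Xi> $ k)))"
  have split: "energy s (\<chi> i. if i = k then x else \<Xi> $ i) =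
      1/2 * (s $ k)\<^sup>2 * (1 - (norm x)\<^sup>2)\<^sup>2
      + (\<Sum>h\<in>UNIV - {k}. s $ k * s $ h * pair_energy x (\<Xi> $ h)) + c" for x
  proof -
    define Z where "Z = (\<chi> i. if i = k then x else \<Xi> $ i)"
    have Zk: "Z $ k = x" and Zi: "\<And>i. i \<noteq> k \<Longrightarrow> Z $ i = \<Xi> $ i"
      unfolding Z_def by auto
    have 1: "(\<Sum>i\<in>UNIV. (s $ i)\<^sup>2 * (1 - (norm (Z $ i))\<^sup>2)\<^sup>2) =
        (s $ k)\<^sup>2 * (1 - (norm x)\<^sup>2)\<^sup>2 + (\<Sum>i\<in>UNIV - {k}. (s $ i)\<^sup>2 * (1 - (norm (\<Xi> $ i))\<^sup>2)\<^sup>2)"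
      by (subst sum.remove[of _ k]) (auto simp: Zk Zi intro!: sum.cong)
    have 2: "(\<Sum>i\<in>UNIV. \<Sum>j\<in>{i<..}. s $ i * s $ j * pair_energy (Z $ i) (Z $ j)) =
        (\<Sum>h\<in>UNIV - {k}. s $ k * s $ h * pair_energy x (\<Xi> $ h))
        + (\<Sum>i\<in>UNIV - {k}. \<Sum>j\<in>{i<..} - {k}. s $ i * s $ j * pair_energy (\<Xi> $ i) (\<Xi> $ j))"
      by (subst sum_pairs_containing[where k = k])
         (auto simp: Zk Zi pair_energy_commute mult.commute intro!: sum.cong)
    show ?thesis
      unfolding Z_def[symmetric] energy_pair_energy 1 2 c_def by (simp add: algebra_simps)
  qed
  define w where "w = (\<lambda>x::real^2. (norm x)\<^sup>2)"
  have dw: "(w has_derivative (\<lambda>h. inner h (2 *\<^sub>R \<Xi> $ k))) (at (\<Xi> $ k))"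
    using GDERIV_norm_sq_diff[of 0 "\<Xi> $ k"] unfolding gderiv_def w_def by simp
  have "((\<lambda>x. 1/2 * (s $ k)\<^sup>2 * (1 - w x)\<^sup>2) has_derivative
      (\<lambda>h. inner h (- (2 * (s $ k)\<^sup>2 * (1 - w (\<Xi> $ k))) *\<^sub>R \<Xi> $ k))) (at (\<Xi> $ k))"
    by (auto intro!: derivative_eq_intros dw ext simp: algebra_simps power2_eq_square)
  then have d1: "((\<lambda>x. 1/2 * (s $ k)\<^sup>2 * (1 - (norm x)\<^sup>2)\<^sup>2) has_derivative
      (\<lambda>h. inner h (- (2 * (s $ k)\<^sup>2 * (1 - (norm (\<Xi> $ k))\<^sup>2)) *\<^sub>R \<Xi> $ k))) (at (\<Xi> $ k))"
    unfolding w_def .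
  have d2: "((\<lambda>x. \<Sum>h\<in>UNIV - {k}. s $ k * s $ h * pair_energy x (\<Xi> $ h)) has_derivative
      (\<lambda>y. \<Sum>h\<in>UNIV - {k}. s $ k * s $ h * inner y (G h))) (at (\<Xi> $ k))"
    using GDERIV_pair_energy[OF in_ball in_ball neq] unfolding gderiv_def G_def
    by (intro has_derivative_sum has_derivative_mult_right) auto
  have "((\<lambda>x. energy s (\<chi> i. if i = k then x else \<Xi> $ i)) has_derivative
      (\<lambda>y. inner y (- (2 * (s $ k)\<^sup>2 * (1 - (norm (\<Xi> $ k))\<^sup>2)) *\<^sub>R \<Xi> $ k)
         + (\<Sum>h\<in>UNIV - {k}. s $ k * s $ h * inner y (G h)))) (at (\<Xi> $ k))"
    unfolding split using has_derivative_add[OF has_derivative_add[OF d1 d2] has_derivative_const[of c]]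
    by simp
  moreover have "inner y (- (2 * (s $ k)\<^sup>2 * (1 - (norm (\<Xi> $ k))\<^sup>2)) *\<^sub>R \<Xi> $ k)
         + (\<Sum>h\<in>UNIV - {k}. s $ k * s $ h * inner y (G h)) =
      inner y (- ((2 * (s $ k)\<^sup>2 * (1 - (norm (\<Xi> $ k))\<^sup>2)) *\<^sub>R \<Xi> $ k
       + (\<Sum>h\<in>UNIV - {k}. (2 * s $ k * s $ h * (1 - Phi (\<Xi> $ k) (\<Xi> $ h))
            * (1 - (norm (\<Xi> $ h))\<^sup>2)) *\<^sub>R \<Xi> $ k)
       + (\<Sum>h\<in>UNIV - {k}. (2 * s $ k * s $ h * (1 - Phi (\<Xi> $ k) (\<Xi> $ h)
            + ln (Phi (\<Xi> $ k) (\<Xi> $ h)))) *\<^sub>R (\<Xi> $ h - \<Xi> $ k))))" for y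
  proof -
    have "s $ k * s $ h * inner y (G h) =
       - inner y ((2 * s $ k * s $ h * (1 - Phi (\<Xi> $ k) (\<Xi> $ h)) * (1 - (norm (\<Xi> $ h))\<^sup>2)) *\<^sub>R \<Xi> $ k)
       - inner y ((2 * s $ k * s $ h * (1 - Phi (\<Xi> $ k) (\<Xi> $ h)
            + ln (Phi (\<Xi> $ k) (\<Xi> $ h)))) *\<^sub>R (\<Xi> $ h - \<Xi> $ k))" for h
      unfolding G_def by (simp add: inner_simps algebra_simps)
    then show ?thesis
      by (simp only: inner_minus_right inner_add_right inner_sum_right sum_subtractf sum_negf
          scaleR_minus_left minus_add_distrib)
  qed
  ultimately show ?thesis
    unfolding gderiv_def by simp
qed

lemma force_explicit:
  fixes s :: "real^'n::{finite,linorder}"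
  assumes "\<Xi> \<in> config_space"
  shows "force s k \<Xi> =
    (2 * (s $ k)\<^sup>2 * (1 - (norm (\<Xi> $ k))\<^sup>2)) *\<^sub>R \<Xi> $ k
    + (\<Sum>h\<in>UNIV - {k}. (2 * s $ k * s $ h * (1 - Phi (\<Xi> $ k) (\<Xi> $ h))
         * (1 - (norm (\<Xi> $ h))\<^sup>2)) *\<^sub>R \<Xi> $ k)
    + (\<Sum>h\<in>UNIV - {k}. (2 * s $ k * s $ h * (1 - Phi (\<Xi> $ k) (\<Xi> $ h)
         + ln (Phi (\<Xi> $ k) (\<Xi> $ h)))) *\<^sub>R (\<Xi> $ h - \<Xi> $ k))"
proof -
  have The: "(THE D. GDERIV f x :> D) = E" if "GDERIV f x :> E"
    for f :: "real^2 \<Rightarrow> real" and x E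
    using that by (blast intro: GDERIV_unique)
  show ?thesis
    unfolding force_def partial_gradient_def The[OF GDERIV_energy[OF assms]] by simp
qed

end

theory Submission
  imports Defs
begin

text \<open>
  The forces are built from smooth functions, hence are locally Lipschitz on the open set
  \<^const>\<open>config_space\<close>. Composing the field with the projection onto a small ball makes it globally
  Lipschitz and bounded, so that the Picard operator is a contraction on bounded continuous functions;
  its fixed point does not leave the ball for a short time. Two solutions agree on a clopen subset
  of the time interval, where openness follows from the mean value inequality.
\<close>

section \<open>Functions that are Lipschitz near a point\<close>

text \<open>The two points range independently over a neighbourhood of \<open>x\<close>, so this is
  Lipschitz continuity near \<open>x\<close>, not only a comparison with \<open>f x\<close>. In
  filter form the estimates for several functions combine without shrinking radii by hand.\<close>

definition locally_lipschitz_at :: "('a::real_normed_vector \<Rightarrow> 'b::real_normed_vector) \<Rightarrow> 'a \<Rightarrow> bool" where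
  "locally_lipschitz_at f x \<longleftrightarrow>
     (\<exists>L\<ge>0. \<forall>\<^sub>F (y, z) in nhds x \<times>\<^sub>F nhds x. norm (f y - f z) \<le> L * norm (y - z))"

text \<open>Replacing \<open>L\<close> by its absolute value only weakens the bound, so the rules
  below need not check the sign of their constants.\<close>

lemma locally_lipschitz_atI:
  assumes "\<forall>\<^sub>F (y, z) in nhds x \<times>\<^sub>F nhds x. norm (f y - f z) \<le> L * norm (y - z)"
  shows "locally_lipschitz_at f x"
  unfolding locally_lipschitz_at_def
proof (intro exI conjI)
  show "\<forall>\<^sub>F (y, z) in nhds x \<times>\<^sub>F nhds x. norm (f y - f z) \<le> \<bar>L\<bar> * norm (y - z)"
    using assms
  proof (rule eventually_mono, clarsimp)
    fix y z assume "norm (f y - f z) \<le> L * norm (y - z)"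
    also have "\<dots> \<le> \<bar>L\<bar> * norm (y - z)" by (intro mult_right_mono) auto
    finally show "norm (f y - f z) \<le> \<bar>L\<bar> * norm (y - z)" .
  qed
qed simp

text \<open>An event in the product of a filter with itself is governed by a single predicate
  \<open>P\<close> imposed on both points, and \<open>P\<close> holds on some ball. The ball form is
  the one that serves for differential equations.\<close>

lemma locally_lipschitz_at_ball:
  "locally_lipschitz_at f x \<longleftrightarrow> (\<exists>r>0. \<exists>L. L-lipschitz_on (ball x r) f)"
proof
  assume "locally_lipschitz_at f x"
  then obtain L where L: "L \<ge> 0"
    "\<forall>\<^sub>F (y, z) in nhds x \<times>\<^sub>F nhds x. norm (f y - f z) \<le> L * norm (y - z)"
    unfolding locally_lipschitz_at_def by blast
  then obtain P where P: "eventually P (nhds x)"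
    "\<And>y z. P y \<Longrightarrow> P z \<Longrightarrow> norm (f y - f z) \<le> L * norm (y - z)"
    unfolding eventually_prod_same by auto
  then obtain r where "r > 0" "\<And>y. dist y x < r \<Longrightarrow> P y"
    unfolding eventually_nhds_metric by blast
  then have "L-lipschitz_on (ball x r) f"
    using P(2) L(1) by (auto simp: lipschitz_on_def dist_norm norm_minus_commute)
  with \<open>r > 0\<close> show "\<exists>r>0. \<exists>L. L-lipschitz_on (ball x r) f" by blast
next
  assume "\<exists>r>0. \<exists>L. L-lipschitz_on (ball x r) f"
  then obtain r L where r: "r > 0" "L-lipschitz_on (ball x r) f" by blast
  have "\<forall>\<^sub>F y in nhds x. y \<in> ball x r"
    using r(1) by (intro eventually_nhds_in_open) auto
  then have "\<forall>\<^sub>F (y, z) in nhds x \<times>\<^sub>F nhds x. norm (f y - f z) \<le> L * norm (y - z)"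
    unfolding eventually_prod_same
    using lipschitz_onD[OF r(2)] by (auto simp: dist_norm intro!: exI[of _ "\<lambda>y. y \<in> ball x r"])
  then show "locally_lipschitz_at f x" by (rule locally_lipschitz_atI)
qed

lemma locally_lipschitz_at_isCont:
  assumes "locally_lipschitz_at f x"
  shows "isCont f x"
proof -
  obtain r L where "r > 0" "L-lipschitz_on (ball x r) f"
    using assms unfolding locally_lipschitz_at_ball by blast
  then show ?thesis
    using lipschitz_on_continuous_on continuous_on_eq_continuous_at[OF open_ball] by force
qed

lemma eventually_prod_nhds1:
  assumes "eventually P (nhds x)"
  shows "\<forall>\<^sub>F (y, z) in nhds x \<times>\<^sub>F nhds x. P y" "\<forall>\<^sub>F (y, z) in nhds x \<times>\<^sub>F nhds x. P z"
  using assms unfolding eventually_prod_same by auto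

section \<open>Closure rules for local Lipschitz continuity\<close>

lemma bounded_linear_locally_lipschitz_at:
  assumes "bounded_linear f"
  shows "locally_lipschitz_at f x"
proof -
  interpret bounded_linear f by fact
  obtain K where "\<And>y. norm (f y) \<le> norm y * K" using bounded by blast
  then show ?thesis
    by (intro locally_lipschitz_atI[where L = K] always_eventually)
       (auto simp: diff[symmetric] mult.commute)
qed

lemma locally_lipschitz_at_const: "locally_lipschitz_at (\<lambda>y. c) x"
  by (rule locally_lipschitz_atI[where L = 0]) (simp add: case_prod_unfold)

lemma locally_lipschitz_at_add:
  assumes "locally_lipschitz_at f x" "locally_lipschitz_at g x"
  shows "locally_lipschitz_at (\<lambda>y. f y + g y) x"
proof -
  obtain K L where
    "\<forall>\<^sub>F (y, z) in nhds x \<times>\<^sub>F nhds x. norm (f y - f z) \<le> K * norm (y - z)"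
    "\<forall>\<^sub>F (y, z) in nhds x \<times>\<^sub>F nhds x. norm (g y - g z) \<le> L * norm (y - z)"
    using assms unfolding locally_lipschitz_at_def by blast
  then have "\<forall>\<^sub>F (y, z) in nhds x \<times>\<^sub>F nhds x.
      norm ((f y + g y) - (f z + g z)) \<le> (K + L) * norm (y - z)"
  proof eventually_elim
    case (elim p)
    obtain y z where p: "p = (y, z)" by fastforce
    have "norm ((f y + g y) - (f z + g z)) \<le> norm (f y - f z) + norm (g y - g z)"
      by (metis add_diff_add norm_triangle_ineq)
    then show ?case using elim unfolding p by (auto simp: distrib_right)
  qed
  then show ?thesis by (rule locally_lipschitz_atI)
qed

text \<open>Continuity of \<open>f\<close> at \<open>x\<close> sends pairs near \<open>x\<close> to
  pairs near \<open>f x\<close>, so the estimate for \<open>g\<close> pulls back along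
  \<open>f\<close> and the constants multiply.\<close>

lemma locally_lipschitz_at_compose:
  assumes f: "locally_lipschitz_at f x" and g: "locally_lipschitz_at g (f x)"
  shows "locally_lipschitz_at (\<lambda>y. g (f y)) x"
proof -
  obtain K where K: "\<forall>\<^sub>F (y, z) in nhds x \<times>\<^sub>F nhds x. norm (f y - f z) \<le> K * norm (y - z)"
    using f unfolding locally_lipschitz_at_def by blast
  obtain L where L: "L \<ge> 0"
    "\<forall>\<^sub>F (y, z) in nhds (f x) \<times>\<^sub>F nhds (f x). norm (g y - g z) \<le> L * norm (y - z)"
    using g unfolding locally_lipschitz_at_def by blast
  have "filterlim f (nhds (f x)) (nhds x)"
    using locally_lipschitz_at_isCont[OF f] by (simp add: continuous_at tendsto_at_iff_tendsto_nhds)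
  then have "filterlim (\<lambda>(y, z). (f y, f z)) (nhds (f x) \<times>\<^sub>F nhds (f x)) (nhds x \<times>\<^sub>F nhds x)"
    unfolding case_prod_unfold
    by (intro filterlim_Pair) (auto intro: filterlim_compose filterlim_fst filterlim_snd)
  from eventually_compose_filterlim[OF L(2) this]
  have "\<forall>\<^sub>F (y, z) in nhds x \<times>\<^sub>F nhds x. norm (g (f y) - g (f z)) \<le> L * norm (f y - f z)"
    by (simp add: case_prod_unfold)
  with K have "\<forall>\<^sub>F (y, z) in nhds x \<times>\<^sub>F nhds x. norm (g (f y) - g (f z)) \<le> (L * K) * norm (y - z)"
  proof eventually_elim
    case (elim p)
    then show ?case
      using mult_left_mono[OF _ L(1)] by (fastforce simp: mult.assoc)
  qed
  then show ?thesis by (rule locally_lipschitz_atI)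
qed

lemma locally_lipschitz_at_norm_le:
  assumes "locally_lipschitz_at f x"
  shows "\<forall>\<^sub>F y in nhds x. norm (f y) \<le> norm (f x) + 1"
proof -
  have "(f \<longlongrightarrow> f x) (nhds x)"
    using locally_lipschitz_at_isCont[OF assms]
    by (simp add: continuous_at tendsto_at_iff_tendsto_nhds)
  then have "((\<lambda>y. norm (f y)) \<longlongrightarrow> norm (f x)) (nhds x)" by (rule tendsto_norm)
  then have "\<forall>\<^sub>F y in nhds x. norm (f y) < norm (f x) + 1" by (rule order_tendstoD) simp
  then show ?thesis by (rule eventually_mono) simp
qed

text \<open>One product rule covers scalar multiples, real products and inner products.\<close>

lemma locally_lipschitz_at_bilinear:
  assumes "bounded_bilinear m" "locally_lipschitz_at f x" "locally_lipschitz_at g x"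
  shows "locally_lipschitz_at (\<lambda>y. m (f y) (g y)) x"
proof -
  interpret bounded_bilinear m by fact
  obtain C where C: "C > 0" "\<And>a b. norm (m a b) \<le> norm a * norm b * C"
    using pos_bounded by blast
  obtain K L where KL: "K \<ge> 0" "L \<ge> 0" and fg:
    "\<forall>\<^sub>F (y, z) in nhds x \<times>\<^sub>F nhds x. norm (f y - f z) \<le> K * norm (y - z)"
    "\<forall>\<^sub>F (y, z) in nhds x \<times>\<^sub>F nhds x. norm (g y - g z) \<le> L * norm (y - z)"
    using assms unfolding locally_lipschitz_at_def by blast
  from fg have "\<forall>\<^sub>F (y, z) in nhds x \<times>\<^sub>F nhds x.
      norm (m (f y) (g y) - m (f z) (g z))
        \<le> (K * (norm (g x) + 1) * C + (norm (f x) + 1) * L * C) * norm (y - z)"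
    using eventually_prod_nhds1(1)[OF locally_lipschitz_at_norm_le[OF assms(3)]]
      eventually_prod_nhds1(2)[OF locally_lipschitz_at_norm_le[OF assms(2)]]
  proof eventually_elim
    case (elim p)
    obtain y z where p: "p = (y, z)" by fastforce
    \<comment> \<open>Each summand has one difference as a factor. The other factor,
      \<open>g y\<close> or \<open>f z\<close>, is bounded near \<open>x\<close> by its norm at
      \<open>x\<close> plus 1.\<close>
    have "m (f y) (g y) - m (f z) (g z) = m (f y - f z) (g y) + m (f z) (g y - g z)"
      by (simp add: diff_left diff_right)
    then have "norm (m (f y) (g y) - m (f z) (g z))
        \<le> norm (m (f y - f z) (g y)) + norm (m (f z) (g y - g z))"
      by (simp add: norm_triangle_ineq)
    also have "\<dots> \<le> norm (f y - f z) * norm (g y) * C + norm (f z) * norm (g y - g z) * C"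
      by (intro add_mono C)
    also have "\<dots> \<le> (K * norm (y - z)) * (norm (g x) + 1) * C
        + (norm (f x) + 1) * (L * norm (y - z)) * C"
      using elim KL C(1) unfolding p by (intro add_mono mult_mono mult_nonneg_nonneg) auto
    finally show ?case unfolding p by (simp add: algebra_simps)
  qed
  then show ?thesis by (rule locally_lipschitz_atI)
qed

lemmas locally_lipschitz_at_scaleR = locally_lipschitz_at_bilinear[OF bounded_bilinear_scaleR]
lemmas locally_lipschitz_at_mult = locally_lipschitz_at_bilinear[OF bounded_bilinear_mult]
lemmas locally_lipschitz_at_inner = locally_lipschitz_at_bilinear[OF bounded_bilinear_inner]

lemma locally_lipschitz_at_diff:
  assumes "locally_lipschitz_at f x" "locally_lipschitz_at g x"
  shows "locally_lipschitz_at (\<lambda>y. f y - g y) x"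
  using locally_lipschitz_at_add[OF assms(1) locally_lipschitz_at_compose[OF assms(2)
      bounded_linear_locally_lipschitz_at[OF bounded_linear_minus[OF bounded_linear_ident]]]]
  by simp

lemma locally_lipschitz_at_sum:
  assumes "\<And>i. i \<in> I \<Longrightarrow> locally_lipschitz_at (f i) x"
  shows "locally_lipschitz_at (\<lambda>y. \<Sum>i\<in>I. f i y) x"
  using assms
  by (induction I rule: infinite_finite_induct)
     (auto intro: locally_lipschitz_at_const locally_lipschitz_at_add)

text \<open>The index type is finite, so all component estimates hold near \<open>x\<close> at once.
  The Euclidean norm is at most the sum of the component norms, hence the constants add up.\<close>

lemma locally_lipschitz_at_vec_lambda:
  assumes "\<And>i. locally_lipschitz_at (f i) x"
  shows "locally_lipschitz_at (\<lambda>y. \<chi> i. f i y) x"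
proof -
  have "\<forall>i. \<exists>L. \<forall>\<^sub>F (y, z) in nhds x \<times>\<^sub>F nhds x. norm (f i y - f i z) \<le> L * norm (y - z)"
    using assms unfolding locally_lipschitz_at_def by blast
  then obtain L where L:
    "\<forall>i. \<forall>\<^sub>F (y, z) in nhds x \<times>\<^sub>F nhds x. norm (f i y - f i z) \<le> L i * norm (y - z)"
    by (rule choice[THEN exE])
  have "\<forall>\<^sub>F p in nhds x \<times>\<^sub>F nhds x.
      \<forall>i. norm (f i (fst p) - f i (snd p)) \<le> L i * norm (fst p - snd p)"
    using L by (intro eventually_all_finite) (simp add: case_prod_unfold)
  then have "\<forall>\<^sub>F (y, z) in nhds x \<times>\<^sub>F nhds x.
      norm ((\<chi> i. f i y) - (\<chi> i. f i z)) \<le> (\<Sum>i\<in>UNIV. L i) * norm (y - z)"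
  proof eventually_elim
    case (elim p)
    obtain y z where p: "p = (y, z)" by fastforce
    have "norm ((\<chi> i. f i y) - (\<chi> i. f i z)) \<le> (\<Sum>i\<in>UNIV. norm (f i y - f i z))"
      unfolding norm_vec_def by (rule order_trans[OF L2_set_le_sum]) auto
    also have "\<dots> \<le> (\<Sum>i\<in>UNIV. L i * norm (y - z))"
      using elim unfolding p by (intro sum_mono) auto
    finally show ?case unfolding p by (simp add: sum_distrib_right)
  qed
  then show ?thesis by (rule locally_lipschitz_atI)
qed

section \<open>Continuously differentiable real functions, logarithm and quotient\<close>

text \<open>The derivative is bounded on a compact ball around \<open>a\<close>, and the mean value
  inequality turns that bound into a Lipschitz constant.\<close>

lemma C1_locally_lipschitz_at:
  fixes g :: "real \<Rightarrow> real"
  assumes S: "open S" "a \<in> S" and g: "\<And>y. y \<in> S \<Longrightarrow> (g has_real_derivative g' y) (at y)"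
    and g': "continuous_on S g'"
  shows "locally_lipschitz_at g a"
proof -
  obtain r where r: "r > 0" "cball a r \<subseteq> S" using S open_contains_cball by blast
  have "compact (g' ` cball a r)"
    using continuous_on_subset[OF g' r(2)] by (intro compact_continuous_image) auto
  then obtain B where B: "\<And>y. y \<in> cball a r \<Longrightarrow> \<bar>g' y\<bar> \<le> B"
    using compact_imp_bounded[OF \<open>compact (g' ` cball a r)\<close>] unfolding bounded_iff real_norm_def by blast
  have "B \<ge> 0" using B[of a] r(1) by auto
  then have "B-lipschitz_on (ball a r) g"
  proof (intro lipschitz_onI)
    fix x y assume "x \<in> ball a r" "y \<in> ball a r"
    then have "norm (g x - g y) \<le> B * norm (x - y)"
      using r(2) by (intro field_differentiable_bound[of "ball a r" g g' B])
        (auto intro!: has_field_derivative_at_within g B)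
    then show "dist (g x) (g y) \<le> B * dist x y" by (simp add: dist_norm)
  qed
  then show ?thesis unfolding locally_lipschitz_at_ball using r(1) by blast
qed

lemma locally_lipschitz_at_ln:
  fixes f :: "'a::real_normed_vector \<Rightarrow> real"
  assumes "locally_lipschitz_at f x" "f x > 0"
  shows "locally_lipschitz_at (\<lambda>y. ln (f y)) x"
proof (rule locally_lipschitz_at_compose[OF assms(1)])
  show "locally_lipschitz_at ln (f x)"
    using assms(2) by (intro C1_locally_lipschitz_at[of "{0<..}" _ _ "\<lambda>y. 1 / y"])
      (auto intro!: derivative_eq_intros continuous_intros)
qed

lemma locally_lipschitz_at_divide:
  fixes f :: "'a::real_normed_vector \<Rightarrow> real"
  assumes "locally_lipschitz_at f x" "locally_lipschitz_at g x" "g x \<noteq> 0"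
  shows "locally_lipschitz_at (\<lambda>y. f y / g y) x"
  unfolding divide_inverse
proof (rule locally_lipschitz_at_mult[OF assms(1) locally_lipschitz_at_compose[OF assms(2)]])
  show "locally_lipschitz_at inverse (g x)"
    using assms(3) by (intro C1_locally_lipschitz_at[of "- {0}" _ _ "\<lambda>y. - (inverse y ^ 2)"])
      (auto intro!: derivative_eq_intros continuous_intros simp: power2_eq_square)
qed

section \<open>Autonomous ordinary differential equations\<close>

text \<open>The mean value inequality \<open>differentiable_bound\<close> asks for operator norms;
  this supplies them for derivatives given as vectors.\<close>

lemma onorm_scaleR_left_le:
  fixes v :: "'a::real_normed_vector"
  assumes "norm v \<le> B"
  shows "onorm (\<lambda>h. h *\<^sub>R v) \<le> B"
proof (rule onorm_le)
  fix h :: real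
  show "norm (h *\<^sub>R v) \<le> B * norm h"
    using mult_right_mono[OF assms abs_ge_zero[of h]] by (simp add: mult.commute)
qed

text \<open>Banach's fixed point theorem for the Picard operator in the sup metric; the interval is
  short enough, \<open>e * L < 1\<close>, for a contraction.\<close>

lemma picard_global:
  fixes f :: "'a::banach \<Rightarrow> 'a"
  assumes f: "L-lipschitz_on UNIV f" and bnd: "\<And>x. norm (f x) \<le> M"
    and e: "e > 0" "e * L < 1"
  shows "\<exists>y. y 0 = x0 \<and> (\<forall>t\<in>{-e..e}. (y has_vector_derivative f (y t)) (at t within {-e..e}))"
proof -
  have cf: "continuous_on UNIV f" using f by (rule lipschitz_on_continuous_on)
  have L: "L \<ge> 0" using f by (rule lipschitz_on_nonneg)
  \<comment> \<open>Time is clamped to the interval, so that a function on \<open>{-e..e}\<close>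
    extends to a bounded continuous function on the whole line.\<close>
  define c where "c = (\<lambda>t. max (-e) (min e t))"
  have c: "c t \<in> {-e..e}" for t using e unfolding c_def by auto
  have c_id: "c t = t" if "t \<in> {-e..e}" for t using that unfolding c_def by auto
  have cc: "continuous_on UNIV c" unfolding c_def by (intro continuous_intros)
  \<comment> \<open>This is the oriented integral from 0 to \<open>t\<close>. The difference form is
    needed for negative \<open>t\<close>, where \<open>{0..t}\<close> is empty.\<close>
  define J where "J = (\<lambda>(g::real \<Rightarrow> 'a) t. integral {-e..t} g - integral {-e..0} g)"
  have J_deriv: "(J g has_vector_derivative g t) (at t within {-e..e})"
    if "continuous_on {-e..e} g" "t \<in> {-e..e}" for g t
    unfolding J_def
    using has_vector_derivative_diff[OF integral_has_vector_derivative[OF that] has_vector_derivative_const]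
    by simp
  \<comment> \<open>\<open>J g\<close> vanishes at 0 and has derivative \<open>g\<close>, so the
    mean value inequality bounds it by \<open>B\<close> times the distance to 0.\<close>
  have J_bound: "norm (J g t) \<le> e * B"
    if g: "continuous_on {-e..e} g" and t: "t \<in> {-e..e}" and B: "\<And>u. u \<in> {-e..e} \<Longrightarrow> norm (g u) \<le> B"
    for g t B
  proof -
    have B0: "B \<ge> 0" using order_trans[OF norm_ge_zero B[OF t]] .
    have "norm (J g t - J g 0) \<le> B * norm (t - 0)"
    proof (rule differentiable_bound[of "{-e..e}" _ "\<lambda>u h. h *\<^sub>R g u"])
      show "(J g has_derivative (\<lambda>h. h *\<^sub>R g u)) (at u within {-e..e})" if "u \<in> {-e..e}" for u
        using J_deriv[OF g that] unfolding has_vector_derivative_def .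
      show "onorm (\<lambda>h. h *\<^sub>R g u) \<le> B" if "u \<in> {-e..e}" for u
        by (intro onorm_scaleR_left_le B that)
    qed (use t e in auto)
    also have "B * norm (t - 0) \<le> B * e" using t B0 by (intro mult_left_mono) auto
    finally show ?thesis unfolding J_def by (simp add: mult.commute)
  qed
  have cJ: "continuous_on {-e..e} (J g)" if "continuous_on {-e..e} g" for g
    unfolding continuous_on_eq_continuous_within
    using has_vector_derivative_continuous[OF J_deriv[OF that]] by blast
  define P where "P = (\<lambda>y :: real \<Rightarrow>\<^sub>C 'a. Bcontfun (\<lambda>t. x0 + J (\<lambda>u. f (y u)) (c t)))"
  have cy: "continuous_on {-e..e} (\<lambda>u. f (apply_bcontfun y u))" for y
    by (rule continuous_on_compose2[OF cf continuous_on_apply_bcontfun]) auto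
  have P: "apply_bcontfun (P y) t = x0 + J (\<lambda>u. f (y u)) (c t)" for y t
  proof -
    have "continuous_on UNIV (\<lambda>t. x0 + J (\<lambda>u. f (y u)) (c t))"
      by (intro continuous_intros continuous_on_compose2[OF cJ[OF cy] cc]) (use c in auto)
    moreover have "norm (x0 + J (\<lambda>u. f (y u)) (c t)) \<le> norm x0 + e * M" for t
      by (intro order_trans[OF norm_triangle_ineq] add_left_mono J_bound cy c bnd)
    ultimately have "(\<lambda>t. x0 + J (\<lambda>u. f (y u)) (c t)) \<in> bcontfun"
      by (intro bcontfun_normI)
    then show ?thesis unfolding P_def by (simp add: Bcontfun_inverse)
  qed
  have "\<exists>!y. P y = y"
  proof (rule banach_fix_type)
    show "0 \<le> e * L" "e * L < 1" using e L by auto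
    have "dist (P y) (P z) \<le> e * L * dist y z" for y z
    proof (rule dist_bound)
      fix t
      have "J (\<lambda>u. f (y u)) s - J (\<lambda>u. f (z u)) s = J (\<lambda>u. f (y u) - f (z u)) s" if "s \<in> {-e..e}" for s
      proof -
        have "(\<lambda>u. f (apply_bcontfun w u)) integrable_on {-e..s'}" if "s' \<le> e" for w s'
          using continuous_on_subset[OF cy] that by (intro integrable_continuous_real) auto
        then show ?thesis using that e unfolding J_def by (simp add: integral_diff)
      qed
      then have "dist (P y t) (P z t) = norm (J (\<lambda>u. f (y u) - f (z u)) (c t))"
        using c by (simp add: P dist_norm)
      also have "\<dots> \<le> e * (L * dist y z)"
      proof (rule J_bound[OF _ c])
        show "continuous_on {-e..e} (\<lambda>u. f (y u) - f (z u))" by (intro continuous_intros cy)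
        fix u
        have "norm (f (y u) - f (z u)) \<le> L * dist (y u) (z u)"
          using lipschitz_onD[OF f, of "y u" "z u"] by (simp add: dist_norm)
        also have "\<dots> \<le> L * dist y z" using L dist_bounded by (intro mult_left_mono) auto
        finally show "norm (f (y u) - f (z u)) \<le> L * dist y z" .
      qed
      finally show "dist (P y t) (P z t) \<le> e * L * dist y z" by (simp add: mult.assoc)
    qed
    then show "\<forall>y z. dist (P y) (P z) \<le> e * L * dist y z" by blast
  qed
  then obtain y where y: "P y = y" by blast
  \<comment> \<open>Inside the interval the clamp is the identity, and the fixed point equation
    becomes the integral equation.\<close>
  have eq: "y t = x0 + J (\<lambda>u. f (y u)) t" if "t \<in> {-e..e}" for t
    using P[of y t] unfolding y c_id[OF that] .
  show ?thesis
  proof (intro exI[of _ "apply_bcontfun y"] conjI ballI)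
    show "y 0 = x0" using eq[of 0] e unfolding J_def by simp
    fix t assume t: "t \<in> {-e..e}"
    have "((\<lambda>t. x0 + J (\<lambda>u. f (y u)) t) has_vector_derivative f (y t)) (at t within {-e..e})"
      using has_vector_derivative_add[OF has_vector_derivative_const J_deriv[OF cy t]] by simp
    then show "(y has_vector_derivative f (y t)) (at t within {-e..e})"
      by (rule has_vector_derivative_transform[OF t eq, rotated])
  qed
qed

text \<open>The nearest-point projection onto a closed ball is 1-Lipschitz, so composing with it
  extends \<open>f\<close> to the whole space with the same constant \<open>L\<close>. Compactness
  of the ball gives the bound \<open>M\<close>.\<close>

lemma picard_local:
  fixes f :: "'a::euclidean_space \<Rightarrow> 'a"
  assumes "r > 0" and f: "L-lipschitz_on (cball x0 r) f"
  shows "\<exists>e>0. \<exists>y. y 0 = x0 \<and> (\<forall>t\<in>{-e<..<e}. y t \<in> cball x0 r \<and>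
    (y has_vector_derivative f (y t)) (at t within {-e<..<e}))"
proof -
  define B where "B = cball x0 r"
  have B: "closed B" "convex B" "B \<noteq> {}" "x0 \<in> B" using \<open>r > 0\<close> unfolding B_def by auto
  define g where "g = (\<lambda>x. f (closest_point B x))"
  have L: "L \<ge> 0" using f by (rule lipschitz_on_nonneg)
  have inB: "closest_point B x \<in> B" for x using B by (intro closest_point_in_set)
  have g: "L-lipschitz_on UNIV g"
  proof (rule lipschitz_onI[OF _ L])
    fix x y
    have "dist (g x) (g y) \<le> L * dist (closest_point B x) (closest_point B y)"
      using lipschitz_onD[OF f] inB unfolding g_def B_def by blast
    also have "\<dots> \<le> L * dist x y"
      using L B by (intro mult_left_mono closest_point_lipschitz) auto
    finally show "dist (g x) (g y) \<le> L * dist x y" .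
  qed
  have "compact (f ` B)"
    using lipschitz_on_continuous_on[OF f] unfolding B_def by (intro compact_continuous_image) auto
  then obtain M where "M > 0" and M: "\<And>x. x \<in> B \<Longrightarrow> norm (f x) \<le> M"
    using compact_imp_bounded[OF \<open>compact (f ` B)\<close>] unfolding bounded_pos by blast
  then have gM: "norm (g x) \<le> M" for x unfolding g_def using inB by blast
  \<comment> \<open>The first term keeps the displacement \<open>e * M\<close> within
    \<open>r\<close>; the second makes \<open>e * L < 1\<close>, where adding 1 to \<open>L\<close>
    covers \<open>L = 0\<close>.\<close>
  define e where "e = min (r / M) (1 / (2 * (L + 1)))"
  have e: "e > 0" "e * M \<le> r" "e * L < 1"
  proof -
    show "e > 0" unfolding e_def using \<open>M > 0\<close> \<open>r > 0\<close> L by auto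
    have "e \<le> r / M" unfolding e_def by simp
    then show "e * M \<le> r" using \<open>M > 0\<close> by (simp add: field_simps)
    have "e * L \<le> 1 / (2 * (L + 1)) * L" unfolding e_def using L by (intro mult_right_mono) auto
    also have "\<dots> < 1" using L by (simp add: field_simps)
    finally show "e * L < 1" .
  qed
  obtain y where y0: "y 0 = x0" and
    y: "\<And>t. t \<in> {-e..e} \<Longrightarrow> (y has_vector_derivative g (y t)) (at t within {-e..e})"
    using picard_global[OF g gM e(1,3)] by blast
  \<comment> \<open>The speed is at most \<open>M\<close>, so the solution stays in the ball; there
    the projection is the identity and \<open>g\<close> agrees with \<open>f\<close>.\<close>
  have yB: "y t \<in> B" if t: "t \<in> {-e..e}" for t
  proof -
    have "norm (y t - y 0) \<le> M * norm (t - 0)"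
    proof (rule differentiable_bound[of "{-e..e}" _ "\<lambda>u h. h *\<^sub>R g (y u)"])
      show "(y has_derivative (\<lambda>h. h *\<^sub>R g (y u))) (at u within {-e..e})" if "u \<in> {-e..e}" for u
        using y[OF that] unfolding has_vector_derivative_def .
      show "onorm (\<lambda>h. h *\<^sub>R g (y u)) \<le> M" for u
        by (intro onorm_scaleR_left_le gM)
    qed (use t e in auto)
    also have "\<dots> \<le> M * e" using t \<open>M > 0\<close> by (intro mult_left_mono) auto
    also have "\<dots> \<le> r" using e(2) by (simp add: mult.commute)
    finally show ?thesis unfolding y0 B_def by (simp add: dist_norm norm_minus_commute)
  qed
  show ?thesis
  proof (intro exI[of _ e] conjI exI[of _ y] ballI)
    fix t assume "t \<in> {-e<..<e}"
    then have t: "t \<in> {-e..e}" by auto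
    show "y t \<in> cball x0 r" using yB[OF t] unfolding B_def .
    have "g (y t) = f (y t)" unfolding g_def closest_point_self[OF yB[OF t]] ..
    then show "(y has_vector_derivative f (y t)) (at t within {-e<..<e})"
      using has_vector_derivative_within_subset[OF y[OF t], of "{-e<..<e}"]
      by (simp add: greaterThanLessThan_subseteq_atLeastAtMost_iff)
  qed (use e y0 in auto)
qed

section \<open>Uniqueness on a connected time interval\<close>

text \<open>Near a time of agreement both solutions lie in a ball on which \<open>f\<close> is
  Lipschitz. On a short interval the maximal distance is at most a factor below 1 times itself,
  hence zero; this replaces Gronwall's inequality.\<close>

lemma ode_unique:
  fixes f :: "'a::real_normed_vector \<Rightarrow> 'a"
  assumes lip: "\<And>x. x \<in> S \<Longrightarrow> locally_lipschitz_at f x"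
    and I: "open I" "connected I" "t0 \<in> I" "y t0 = z t0"
    and y: "\<And>t. t \<in> I \<Longrightarrow> y t \<in> S" "\<And>t. t \<in> I \<Longrightarrow> (y has_vector_derivative f (y t)) (at t)"
    and z: "\<And>t. t \<in> I \<Longrightarrow> (z has_vector_derivative f (z t)) (at t)"
    and t: "t \<in> I"
  shows "y t = z t"
proof -
  define d where "d = (\<lambda>t. y t - z t)"
  have d': "(d has_vector_derivative f (y t) - f (z t)) (at t)" if "t \<in> I" for t
    unfolding d_def by (intro has_vector_derivative_diff y z that)
  have cd: "continuous_on I d"
    using d' has_vector_derivative_continuous continuous_at_imp_continuous_on by blast
  define A where "A = {t \<in> I. d t = 0}"
  have "open A"
    unfolding open_contains_ball
  proof
    fix a assume "a \<in> A"
    then have a: "a \<in> I" "y a = z a" unfolding A_def d_def by auto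
    obtain r L where r: "r > 0" and L: "L-lipschitz_on (ball (y a) r) f"
      using lip[OF y(1)[OF a(1)]] unfolding locally_lipschitz_at_ball by blast
    have L0: "L \<ge> 0" using L by (rule lipschitz_on_nonneg)
    have "\<forall>\<^sub>F u in nhds a. w u \<in> ball (w a) r"
      if "(w has_vector_derivative w') (at a)" for w :: "real \<Rightarrow> 'a" and w'
    proof -
      have "(w \<longlongrightarrow> w a) (nhds a)"
        using has_vector_derivative_continuous[OF that]
        by (simp add: continuous_at tendsto_at_iff_tendsto_nhds)
      then show ?thesis by (rule topological_tendstoD) (use r in auto)
    qed
    from this[OF y(2)[OF a(1)]] this[OF z[OF a(1)]]
    have "\<forall>\<^sub>F u in nhds a. y u \<in> ball (y a) r \<and> z u \<in> ball (y a) r \<and> u \<in> I"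
      unfolding a(2)[symmetric]
      by (intro eventually_conj eventually_nhds_in_open[OF I(1) a(1)])
    then obtain q where q: "q > 0" "\<And>u. dist u a < q \<Longrightarrow> y u \<in> ball (y a) r \<and> z u \<in> ball (y a) r \<and> u \<in> I"
      unfolding eventually_nhds_metric by blast
    \<comment> \<open>Half of \<open>q\<close> leaves room for a closed interval, on which a maximum
      is attained; the second term gives \<open>L * p < 1\<close>.\<close>
    define p where "p = min (q / 2) (1 / (2 * (L + 1)))"
    have p: "p > 0" "p < q" "L * p < 1"
    proof -
      show "p > 0" "p < q" unfolding p_def using q(1) L0 by auto
      have "L * p \<le> L * (1 / (2 * (L + 1)))" unfolding p_def using L0 by (intro mult_left_mono) auto
      also have "\<dots> < 1" using L0 by (simp add: field_simps)
      finally show "L * p < 1" .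
    qed
    have near: "y u \<in> ball (y a) r" "z u \<in> ball (y a) r" "u \<in> I" if "u \<in> cball a p" for u
      using q(2)[of u] that p(2) by (auto simp: dist_commute)
    have "continuous_on (cball a p) (\<lambda>u. norm (d u))"
      using near(3) by (intro continuous_on_norm continuous_on_subset[OF cd]) auto
    then obtain b where b: "b \<in> cball a p" "\<And>u. u \<in> cball a p \<Longrightarrow> norm (d u) \<le> norm (d b)"
      using continuous_attains_sup[of "cball a p"] p(1) by (metis cball_eq_empty compact_cball not_less_iff_gr_or_eq)
    \<comment> \<open>Since \<open>d a = 0\<close>, the left side is the maximum of the distance,
      and the right side will be at most \<open>L * p\<close> times that maximum.\<close>
    have "norm (d b - d a) \<le> (L * norm (d b)) * norm (b - a)"
    proof (rule differentiable_bound[of "cball a p" _ "\<lambda>u h. h *\<^sub>R (f (y u) - f (z u))"])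
      fix u assume u: "u \<in> cball a p"
      show "(d has_derivative (\<lambda>h. h *\<^sub>R (f (y u) - f (z u)))) (at u within cball a p)"
        using d'[OF near(3)[OF u]] has_derivative_at_withinI unfolding has_vector_derivative_def by blast
      have "norm (f (y u) - f (z u)) \<le> L * norm (d u)"
        using lipschitz_onD[OF L near(1,2)[OF u]] unfolding d_def dist_norm .
      also have "\<dots> \<le> L * norm (d b)" using L0 b(2)[OF u] by (rule mult_left_mono[rotated])
      finally show "onorm (\<lambda>h. h *\<^sub>R (f (y u) - f (z u))) \<le> L * norm (d b)"
        by (rule onorm_scaleR_left_le)
    qed (use b p in auto)
    also have "\<dots> \<le> (L * norm (d b)) * p"
      using b(1) L0 by (intro mult_left_mono) (auto simp: dist_real_def)
    finally have "norm (d b) \<le> (L * p) * norm (d b)" using a(2) unfolding d_def by (simp add: mult_ac)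
    then have "(1 - L * p) * norm (d b) \<le> 0" by (simp add: algebra_simps)
    then have "norm (d b) \<le> 0" using p(3) by (simp add: mult_le_0_iff)
    then have "d u = 0" if "u \<in> ball a p" for u
      using b(2)[of u] that by auto
    then have "ball a p \<subseteq> A" unfolding A_def using near(3) by auto
    then show "\<exists>e>0. ball a e \<subseteq> A" using p(1) by blast
  qed
  then have "openin (top_of_set I) A" by (rule open_openin_trans[OF I(1)]) (auto simp: A_def)
  moreover have "closedin (top_of_set I) A"
    unfolding A_def using cd by (rule continuous_closedin_preimage_constant)
  ultimately have "A = {} \<or> A = I" using I(2) unfolding connected_clopen by blast
  moreover have "t0 \<in> A" unfolding A_def d_def using I by simp
  ultimately show ?thesis using t unfolding A_def d_def by auto
qed

section \<open>The force field\<close>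

text \<open>Equality of two components is symmetric and the order is linear, so \<open>k < h\<close>
  may be replaced by \<open>k \<noteq> h\<close>. Openness is then a finite intersection of open
  conditions.\<close>

lemma config_space_iff:
  "\<Xi> \<in> config_space \<longleftrightarrow> (\<forall>i. \<Xi> $ i \<in> ball 0 1) \<and> (\<forall>k h. k \<noteq> h \<longrightarrow> \<Xi> $ k \<noteq> \<Xi> $ h)"
proof -
  have "\<Xi> \<in> superposition_set \<longleftrightarrow> (\<forall>i. \<Xi> $ i \<in> ball 0 1) \<and> (\<exists>k h. k < h \<and> \<Xi> $ k = \<Xi> $ h)"
    unfolding superposition_set_def by auto
  moreover have "(\<exists>k h. k < h \<and> \<Xi> $ k = \<Xi> $ h) \<longleftrightarrow> (\<exists>k h. k \<noteq> h \<and> \<Xi> $ k = \<Xi> $ h)"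
    by (metis linorder_neqE less_irrefl)
  ultimately show ?thesis unfolding config_space_def by auto
qed

lemma open_config_space: "open (config_space :: ((real^2)^'n::{finite,linorder}) set)"
proof -
  have *: "config_space = (\<Inter>i. {\<Xi> :: (real^2)^'n::{finite,linorder}. norm (\<Xi> $ i) < 1}) \<inter>
     (\<Inter>k. \<Inter>h\<in>-{k}. {\<Xi> :: (real^2)^'n::{finite,linorder}. \<Xi> $ k \<noteq> \<Xi> $ h})"
    by (auto simp: config_space_iff)
  show ?thesis
    unfolding * by (intro open_Int open_INT ballI finite open_Collect_less open_Collect_neq continuous_intros)
qed

text \<open>The forces are gathered into one vector field, given by the explicit formula because the
  Lipschitz rules cannot be applied to the description in \<open>partial_gradient\<close>.\<close>

definition force_field ::
  "real^'n::{finite,linorder} \<Rightarrow> (real^2)^'n::{finite,linorder} \<Rightarrow> (real^2)^'n::{finite,linorder}" where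
  "force_field s \<Xi> = (\<chi> k. (2 * (s $ k)\<^sup>2 * (1 - (norm (\<Xi> $ k))\<^sup>2)) *\<^sub>R \<Xi> $ k
    + (\<Sum>h\<in>UNIV - {k}. (2 * s $ k * s $ h * (1 - Phi (\<Xi> $ k) (\<Xi> $ h))
         * (1 - (norm (\<Xi> $ h))\<^sup>2)) *\<^sub>R \<Xi> $ k)
    + (\<Sum>h\<in>UNIV - {k}. (2 * s $ k * s $ h * (1 - Phi (\<Xi> $ k) (\<Xi> $ h)
         + ln (Phi (\<Xi> $ k) (\<Xi> $ h)))) *\<^sub>R (\<Xi> $ h - \<Xi> $ k)))"

lemma force_field_eq: "\<Xi> \<in> config_space \<Longrightarrow> force_field s \<Xi> $ k = force s k \<Xi>"
  by (simp add: force_field_def force_explicit)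

lemma locally_lipschitz_at_norm_sq:
  fixes f :: "'a::real_normed_vector \<Rightarrow> 'b::real_inner"
  shows "locally_lipschitz_at f x \<Longrightarrow> locally_lipschitz_at (\<lambda>y. (norm (f y))\<^sup>2) x"
  unfolding power2_norm_eq_inner by (rule locally_lipschitz_at_inner)

text \<open>The field is assembled from Lipschitz pieces. The only side conditions are a nonzero
  denominator in \<open>Phi\<close> and a positive argument of \<open>ln\<close>; both follow from
  distinct points in the open disk.\<close>

lemma locally_lipschitz_at_force_field:
  assumes "\<Xi> \<in> config_space"
  shows "locally_lipschitz_at (force_field s) \<Xi>"
proof -
  have nth: "locally_lipschitz_at (\<lambda>\<Xi>. \<Xi> $ i) \<Xi>" for i
    by (intro bounded_linear_locally_lipschitz_at bounded_linear_vec_nth)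
  have ball: "\<Xi> $ i \<in> ball 0 1" for i using assms unfolding config_space_iff by blast
  have neq: "\<Xi> $ k \<noteq> \<Xi> $ h" if "h \<in> UNIV - {k}" for k h
    using assms that unfolding config_space_iff by auto
  have Phi: "locally_lipschitz_at (\<lambda>\<Xi>. Phi (\<Xi> $ k) (\<Xi> $ h)) \<Xi>" if "h \<in> UNIV - {k}" for k h
  proof -
    have "Phi (\<Xi> $ k) (\<Xi> $ h) > 0" using Phi_pos_less_one(1)[OF ball ball neq[OF that]] .
    \<comment> \<open>Division by zero yields 0, so positivity of the quotient already forces a
      nonzero denominator.\<close>
    then have "(norm (\<Xi> $ k - \<Xi> $ h))\<^sup>2 + (1 - (norm (\<Xi> $ k))\<^sup>2) * (1 - (norm (\<Xi> $ h))\<^sup>2) \<noteq> 0"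
      unfolding Phi_def by auto
    then show ?thesis
      unfolding Phi_def
      by (intro locally_lipschitz_at_divide locally_lipschitz_at_norm_sq locally_lipschitz_at_diff
          locally_lipschitz_at_add locally_lipschitz_at_mult locally_lipschitz_at_const nth)
  qed
  show ?thesis
    unfolding force_field_def
    by (intro locally_lipschitz_at_vec_lambda locally_lipschitz_at_add locally_lipschitz_at_sum
        locally_lipschitz_at_scaleR locally_lipschitz_at_mult locally_lipschitz_at_diff
        locally_lipschitz_at_const locally_lipschitz_at_norm_sq locally_lipschitz_at_ln nth Phi
        Phi_pos_less_one(1) ball neq)
qed

section \<open>From components to one vector equation\<close>

text \<open>A vector derivative means that the normalized remainder \<open>q\<close> tends to 0, and
  convergence in a finite product is componentwise.\<close>

lemma has_vector_derivative_vec_iff: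
  fixes f :: "real \<Rightarrow> 'a::real_normed_vector^'n"
  shows "(f has_vector_derivative D) F \<longleftrightarrow> (\<forall>i. ((\<lambda>t. f t $ i) has_vector_derivative D $ i) F)"
proof -
  \<comment> \<open>This is the base point that \<open>has_derivative\<close> attaches to an
    arbitrary filter.\<close>
  define x where "x = Lim F (\<lambda>x. x)"
  define q where "q = (\<lambda>y. ((f y - f x) - (y - x) *\<^sub>R D) /\<^sub>R norm (y - x))"
  have "(f has_vector_derivative D) F \<longleftrightarrow> (q \<longlongrightarrow> 0) F"
    unfolding has_vector_derivative_def has_derivative_def q_def x_def
    by (simp add: bounded_linear_scaleR_left)
  also have "\<dots> \<longleftrightarrow> (\<forall>i. ((\<lambda>y. q y $ i) \<longlongrightarrow> 0 $ i) F)"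
    using vec_tendstoI tendsto_vec_nth by blast
  also have "\<dots> \<longleftrightarrow> (\<forall>i. ((\<lambda>t. f t $ i) has_vector_derivative D $ i) F)"
    unfolding has_vector_derivative_def has_derivative_def q_def x_def
    by (simp add: bounded_linear_scaleR_left)
  finally show ?thesis .
qed

lemma solves_cauchy_problem_iff:
  "solves_cauchy_problem s \<Xi>\<^sub>0 I \<Xi> \<longleftrightarrow> \<Xi> 0 = \<Xi>\<^sub>0 \<and> (\<forall>T\<in>I. \<Xi> T \<in> config_space \<and>
     (\<Xi> has_vector_derivative force_field s (\<Xi> T)) (at T within I))"
  unfolding solves_cauchy_problem_def has_vector_derivative_vec_iff
  by (auto simp: force_field_eq)

theorem mainTheorem1:
  fixes s :: "real^'n::{finite,linorder}" and \<Xi>\<^sub>0 :: "(real^2)^'n::{finite,linorder}"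
  assumes "\<forall>k. s $ k \<noteq> 0"
    and "\<Xi>\<^sub>0 \<in> config_space"
  shows "\<exists>\<epsilon>>0. \<exists>\<Xi>. solves_cauchy_problem s \<Xi>\<^sub>0 {-\<epsilon><..<\<epsilon>} \<Xi> \<and>
    (\<forall>\<Theta>. solves_cauchy_problem s \<Xi>\<^sub>0 {-\<epsilon><..<\<epsilon>} \<Theta> \<longrightarrow> (\<forall>T\<in>{-\<epsilon><..<\<epsilon>}. \<Theta> T = \<Xi> T))"
proof -
  obtain r1 L where r1: "r1 > 0" "L-lipschitz_on (ball \<Xi>\<^sub>0 r1) (force_field s)"
    using locally_lipschitz_at_force_field[OF assms(2)] unfolding locally_lipschitz_at_ball by blast
  obtain r2 where r2: "r2 > 0" "ball \<Xi>\<^sub>0 r2 \<subseteq> config_space"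
    using open_config_space assms(2) unfolding open_contains_ball by blast
  \<comment> \<open>Halving makes the closed ball fit inside both open balls.\<close>
  define r where "r = min r1 r2 / 2"
  have r: "r > 0" "cball \<Xi>\<^sub>0 r \<subseteq> ball \<Xi>\<^sub>0 r1" "cball \<Xi>\<^sub>0 r \<subseteq> config_space"
    using r1 r2 unfolding r_def by (auto simp: subset_iff)
  obtain \<epsilon> \<Xi> where "\<epsilon> > 0" and \<Xi>: "\<Xi> 0 = \<Xi>\<^sub>0" "\<And>t. t \<in> {-\<epsilon><..<\<epsilon>} \<Longrightarrow> \<Xi> t \<in> cball \<Xi>\<^sub>0 r"
    "\<And>t. t \<in> {-\<epsilon><..<\<epsilon>} \<Longrightarrow> (\<Xi> has_vector_derivative force_field s (\<Xi> t)) (at t within {-\<epsilon><..<\<epsilon>})"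
    using picard_local[OF r(1) lipschitz_on_subset[OF r1(2) r(2)]] by blast
  have sol: "solves_cauchy_problem s \<Xi>\<^sub>0 {-\<epsilon><..<\<epsilon>} \<Xi>"
    unfolding solves_cauchy_problem_iff using \<Xi> r(3) by blast
  \<comment> \<open>A competitor \<open>\<Theta>\<close> may leave the small ball, so uniqueness
    rests on the local Lipschitz property on all of \<open>config_space\<close>.\<close>
  have "\<Theta> T = \<Xi> T" if \<Theta>: "solves_cauchy_problem s \<Xi>\<^sub>0 {-\<epsilon><..<\<epsilon>} \<Theta>" and T: "T \<in> {-\<epsilon><..<\<epsilon>}" for \<Theta> T
  proof (rule ode_unique[OF locally_lipschitz_at_force_field[of _ s] _ _ _ _ _ _ _ T])
    \<comment> \<open>The time interval is open, so derivatives within it are the two-sided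
      derivatives that \<open>ode_unique\<close> expects.\<close>
    have "at t within {-\<epsilon><..<\<epsilon>} = at t" if "t \<in> {-\<epsilon><..<\<epsilon>}" for t
      using that by (rule at_within_open) auto
    with sol \<Theta> show "t \<in> {-\<epsilon><..<\<epsilon>} \<Longrightarrow> \<Theta> t \<in> config_space"
      "t \<in> {-\<epsilon><..<\<epsilon>} \<Longrightarrow> (\<Theta> has_vector_derivative force_field s (\<Theta> t)) (at t)"
      "t \<in> {-\<epsilon><..<\<epsilon>} \<Longrightarrow> (\<Xi> has_vector_derivative force_field s (\<Xi> t)) (at t)"
      "\<Theta> 0 = \<Xi> 0" for t
      unfolding solves_cauchy_problem_iff by metis+
  qed (use \<open>\<epsilon> > 0\<close> in auto)
  with sol \<open>\<epsilon> > 0\<close> show ?thesis by blast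
qed

end
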